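(* Let $C_{n,0},C_{n,1},C_{n,2},C_{n,12},C_{n,21},C_{n,121}$ ($n\ge1$) be the polynomials in $q$ defined by the expansion, in the Hecke algebra $H_3$, $$(T_1T_2^{-1})^n = q^{-n}\bigl(C_{n,0}+C_{n,1}T_1+C_{n,2}T_2+C_{n,12}T_1T_2+C_{n,21}T_2T_1+C_{n,121}T_1T_2T_1\bigr).$$ Then for all $n\ge 2$ they satisfy the recursion relations \begin{align*} C_{n,0}(q) &= q^2\, C_{n-1,21}(q) - q(q-1)\, C_{n-1,1}(q),\\ C_{n,1}(q) &= -(q-1)^2\, C_{n-1,1}(q) - (q-1)\, C_{n-1,0}(q) + q^2\, C_{n-1,121}(q),\\ C_{n,2}(q) &= q\, C_{n-1,1}(q),\\ C_{n,12}(q) &= (q-1)\, C_{n-1,1}(q) + C_{n-1,0}(q),\\ C_{n,21}(q) &= -(q-1)\, C_{n-1,2}(q) + q\, C_{n-1,12}(q) - (q-1)^2\, C_{n-1,21}(q) + q(q-1)\, C_{n-1,121}(q),\\ C_{n,121}(q) &= C_{n-1,2}(q) + (q-1)\, C_{n-1,21}(q). \end{align*}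
   Context: Let $K=\mathbf{C}(q,z)$ be the field of rational functions in indeterminates $q,z$ (any field in which $q$ is an indeterminate would do). The Hecke algebra $H_3$ is the associative unital $K$-algebra on generators $T_1,T_2$ with relations $T_1T_2T_1=T_2T_1T_2$ and $T_i^2=(q-1)T_i+q$ for $i=1,2$. It has dimension $6$ over $K$ with basis $\{1,T_1,T_2,T_1T_2,T_2T_1,T_1T_2T_1\}$, and each $T_i$ is invertible with $T_i^{-1}=q^{-1}(T_i-(q-1))$. The coefficients $C_{n,*}$ are elements of $\mathbf{Z}[q]$. The initial values are $C_{1,1}=-(q-1)$, $C_{1,12}=1$, and $C_{1,0}=C_{1,2}=C_{1,21}=C_{1,121}=0$. *)

theory Defs
  imports
    "HOL-Computational_Algebra.Computational_Algebra"
    "HOL-Library.Poly_Mapping"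
begin

section \<open>The field of rational functions in q and z\<close>

text \<open>
  The field C(q,z) is the fraction field of C[q][z]: the inner polynomial variable is q, the
  outer one is z.
\<close>

type_synonym ratfun = "complex poly poly fract"

definition qK :: ratfun where
  "qK = Fract [:[:0, 1:]:] 1"

text \<open>The image in the field of a polynomial in Z[q].\<close>

definition of_Zq :: "int poly \<Rightarrow> ratfun" where
  "of_Zq p = poly (map_poly of_int p) qK"


text \<open>The indeterminate of Z[q].\<close>

abbreviation qZ :: "int poly" where
  "qZ \<equiv> [:0, 1:]"


section \<open>The free associative algebra on two generators\<close>

datatype gen = G1 | G2

text \<open>
  Words form a monoid under concatenation, written additively because the convolution product
  of \<^theory>\<open>HOL-Library.Poly_Mapping\<close> is that of the monoid algebra of an additive monoid.
\<close>

datatype gen_word = Word (letters: "gen list")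

instantiation gen_word :: monoid_add
begin

definition zero_gen_word :: gen_word where
  "0 = Word []"

definition plus_gen_word :: "gen_word \<Rightarrow> gen_word \<Rightarrow> gen_word" where
  "u + v = Word (letters u @ letters v)"

instance
  by standard (simp_all add: zero_gen_word_def plus_gen_word_def)

end

type_synonym free_alg = "gen_word \<Rightarrow>\<^sub>0 ratfun"

definition free_const :: "ratfun \<Rightarrow> free_alg" where
  "free_const c = Poly_Mapping.single 0 c"

definition free_gen :: "gen \<Rightarrow> free_alg" where
  "free_gen g = Poly_Mapping.single (Word [g]) 1"

lemma free_alg_induct [case_names single sum]:
  fixes x :: free_alg
  assumes single: "\<And>w c. P (Poly_Mapping.single w c)"
    and sum: "\<And>x y. P x \<Longrightarrow> P y \<Longrightarrow> P (x + y)"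
  shows "P x"
proof (induction x rule: update_induct)
  case const
  then show ?case using single[of 0 0] by simp
next
  case (update f a b)
  have "Poly_Mapping.update a b f = f + Poly_Mapping.single a b"
    using update(1)
    by (intro poly_mapping_eqI)
      (auto simp: lookup_update lookup_add lookup_single when_def in_keys_iff)
  then show ?case using update(3) sum single by simp
qed

lemma free_const_0: "free_const 0 = 0"
  by (simp add: free_const_def)

lemma free_const_1: "free_const 1 = 1"
  by (simp add: free_const_def)

lemma free_const_add: "free_const (a + b) = free_const a + free_const b"
  by (simp add: free_const_def single_add)

lemma free_const_mult: "free_const (a * b) = free_const a * free_const b"
  by (simp add: free_const_def mult_single)

lemma free_const_central: "free_const c * x = x * free_const c"
proof (induction x rule: free_alg_induct)
  case (single u v)
  then show ?case by (simp add: free_const_def mult_single mult.commute)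
next
  case (sum f g)
  then show ?case by (simp add: algebra_simps)
qed


section \<open>The Hecke algebra as a quotient of the free algebra\<close>

text \<open>Differences of the two sides of the defining relations.\<close>

definition hecke_relators :: "free_alg set" where
  "hecke_relators =
     {free_gen G1 * free_gen G2 * free_gen G1 - free_gen G2 * free_gen G1 * free_gen G2}
     \<union> range (\<lambda>g. free_gen g ^ 2 - (free_const (qK - 1) * free_gen g + free_const qK))"

text \<open>The two-sided ideal generated by the relators.\<close>

inductive_set hecke_ideal :: "free_alg set" where
  zero: "0 \<in> hecke_ideal"
| gen: "r \<in> hecke_relators \<Longrightarrow> a * r * b \<in> hecke_ideal"
| add: "x \<in> hecke_ideal \<Longrightarrow> y \<in> hecke_ideal \<Longrightarrow> x + y \<in> hecke_ideal"

lemma hecke_ideal_mult: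
  assumes "x \<in> hecke_ideal"
  shows "a * x * b \<in> hecke_ideal"
  using assms
proof induction
  case zero
  then show ?case by (simp add: hecke_ideal.zero)
next
  case (gen r c d)
  then have "(a * c) * r * (d * b) \<in> hecke_ideal" by (rule hecke_ideal.gen)
  then show ?case by (simp add: mult.assoc)
next
  case (add x y)
  then show ?case by (simp add: distrib_left distrib_right hecke_ideal.add)
qed

lemma hecke_ideal_uminus: "x \<in> hecke_ideal \<Longrightarrow> - x \<in> hecke_ideal"
  using hecke_ideal_mult[of x "- 1" 1] by simp

lemma hecke_ideal_diff: "x \<in> hecke_ideal \<Longrightarrow> y \<in> hecke_ideal \<Longrightarrow> x - y \<in> hecke_ideal"
  using hecke_ideal.add[of x "- y"] hecke_ideal_uminus[of y] by simp

definition hecke_rel :: "free_alg \<Rightarrow> free_alg \<Rightarrow> bool" where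
  "hecke_rel x y \<longleftrightarrow> x - y \<in> hecke_ideal"

lemma equivp_hecke_rel: "equivp hecke_rel"
proof (rule equivpI)
  show "reflp hecke_rel"
    by (rule reflpI) (simp add: hecke_rel_def hecke_ideal.zero)
  show "symp hecke_rel"
    by (rule sympI) (metis hecke_rel_def hecke_ideal_uminus minus_diff_eq)
  show "transp hecke_rel"
  proof (rule transpI)
    fix x y z
    assume "hecke_rel x y" "hecke_rel y z"
    then have "(x - y) + (y - z) \<in> hecke_ideal"
      unfolding hecke_rel_def by (rule hecke_ideal.add)
    then show "hecke_rel x z" by (simp add: hecke_rel_def)
  qed
qed

quotient_type hecke3 = free_alg / hecke_rel
  by (rule equivp_hecke_rel)

text \<open>
  The character of the free algebra sending both generators to q; it kills the relators, so the
  quotient is nontrivial.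
\<close>

definition triv_char :: "free_alg \<Rightarrow> ratfun" where
  "triv_char f = (\<Sum>w\<in>Poly_Mapping.keys f. Poly_Mapping.lookup f w * qK ^ length (letters w))"

lemma triv_char_superset:
  assumes "finite A" "Poly_Mapping.keys f \<subseteq> A"
  shows "triv_char f = (\<Sum>w\<in>A. Poly_Mapping.lookup f w * qK ^ length (letters w))"
  unfolding triv_char_def using assms
  by (intro sum.mono_neutral_left) (auto simp: in_keys_iff)

lemma triv_char_add: "triv_char (f + g) = triv_char f + triv_char g"
proof -
  let ?A = "Poly_Mapping.keys f \<union> Poly_Mapping.keys g"
  have "Poly_Mapping.keys (f + g) \<subseteq> ?A" by (rule keys_add)
  then show ?thesis
    by (simp add: triv_char_superset[of ?A] lookup_add distrib_right sum.distrib)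
qed

lemma triv_char_0: "triv_char 0 = 0"
  by (simp add: triv_char_def)

lemma triv_char_diff: "triv_char (f - g) = triv_char f - triv_char g"
  using triv_char_add[of "f - g" g] by (simp add: algebra_simps)

lemma triv_char_single: "triv_char (Poly_Mapping.single w c) = c * qK ^ length (letters w)"
  by (simp add: triv_char_def)

lemma triv_char_mult: "triv_char (f * g) = triv_char f * triv_char g"
proof (induction f rule: free_alg_induct)
  case (single u v)
  show ?case
  proof (induction g rule: free_alg_induct)
    case (single l w)
    then show ?case
      by (simp add: mult_single triv_char_single plus_gen_word_def power_add)
  next
    case (sum f' g')
    then show ?case by (simp add: distrib_left triv_char_add)
  qed
next
  case (sum f' g')
  then show ?case by (simp add: distrib_right triv_char_add)
qed

lemma triv_char_gen: "triv_char (free_gen g) = qK"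
  by (simp add: free_gen_def triv_char_single)

lemma triv_char_const: "triv_char (free_const c) = c"
  by (simp add: free_const_def triv_char_single zero_gen_word_def)

lemma triv_char_relators: "r \<in> hecke_relators \<Longrightarrow> triv_char r = 0"
  unfolding hecke_relators_def
  by (elim UnE singletonE rangeE; hypsubst)
    (simp_all add: triv_char_diff triv_char_mult triv_char_add triv_char_gen triv_char_const
      power2_eq_square, simp add: algebra_simps)

lemma triv_char_ideal: "x \<in> hecke_ideal \<Longrightarrow> triv_char x = 0"
  by (induction rule: hecke_ideal.induct)
    (simp_all add: triv_char_0 triv_char_mult triv_char_add triv_char_relators)

instantiation hecke3 :: ring_1
begin

lift_definition zero_hecke3 :: hecke3 is "0 :: free_alg" .

lift_definition one_hecke3 :: hecke3 is "1 :: free_alg" .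

lift_definition plus_hecke3 :: "hecke3 \<Rightarrow> hecke3 \<Rightarrow> hecke3" is "(+)"
  unfolding hecke_rel_def by (metis add_diff_add hecke_ideal.add)

lift_definition uminus_hecke3 :: "hecke3 \<Rightarrow> hecke3" is "uminus"
  unfolding hecke_rel_def by (metis hecke_ideal_uminus minus_diff_minus)

lift_definition minus_hecke3 :: "hecke3 \<Rightarrow> hecke3 \<Rightarrow> hecke3" is "(-)"
proof -
  fix a b c d :: free_alg
  assume "hecke_rel a b" "hecke_rel c d"
  then have "(a - b) - (c - d) \<in> hecke_ideal"
    unfolding hecke_rel_def by (rule hecke_ideal_diff)
  then show "hecke_rel (a - c) (b - d)"
    by (simp add: hecke_rel_def algebra_simps)
qed

lift_definition times_hecke3 :: "hecke3 \<Rightarrow> hecke3 \<Rightarrow> hecke3" is "(*)"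
proof -
  fix a b c d :: free_alg
  assume "hecke_rel a b" "hecke_rel c d"
  then have "1 * (a - b) * c + b * (c - d) * 1 \<in> hecke_ideal"
    unfolding hecke_rel_def by (intro hecke_ideal.add hecke_ideal_mult)
  then show "hecke_rel (a * c) (b * d)"
    by (simp add: hecke_rel_def algebra_simps)
qed

instance
proof
  show "(0::hecke3) \<noteq> 1"
  proof (transfer, rule notI)
    assume "hecke_rel 0 1"
    then have "triv_char (free_const 0 - free_const 1) = 0"
      by (simp add: hecke_rel_def triv_char_ideal free_const_0 free_const_1)
    then show False by (simp add: triv_char_diff triv_char_const)
  qed
qed (transfer; simp add: hecke_rel_def algebra_simps hecke_ideal.zero)+

end

lift_definition hecke_scale :: "ratfun \<Rightarrow> hecke3 \<Rightarrow> hecke3" (infixr \<open>*\<^sub>H\<close> 75)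
  is "\<lambda>c x. free_const c * x"
  unfolding hecke_rel_def by (metis hecke_ideal_mult mult.right_neutral right_diff_distrib)

lift_definition T1 :: hecke3 is "free_gen G1" .

lift_definition T2 :: hecke3 is "free_gen G2" .

text \<open>The scaling makes the quotient an associative algebra over the field.\<close>

lemma vector_space_hecke3: "vector_space hecke_scale"
  by standard
    (transfer; simp add: hecke_rel_def free_const_add free_const_mult free_const_1 algebra_simps
      hecke_ideal.zero)+

lemma hecke_scale_mult_left: "(c *\<^sub>H x) * y = c *\<^sub>H (x * y)"
  by transfer (simp add: hecke_rel_def mult.assoc hecke_ideal.zero)

lemma hecke_scale_mult_right: "x * (c *\<^sub>H y) = c *\<^sub>H (x * y)"
  by transfer (metis equivp_hecke_rel equivp_reflp free_const_central mult.assoc)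

lemma hecke_relator_rel:
  assumes "x - y \<in> hecke_relators"
  shows "hecke_rel x y"
  using hecke_ideal.gen[OF assms, of 1 1] by (simp add: hecke_rel_def)

lemma hecke_braid: "T1 * T2 * T1 = T2 * T1 * T2"
  by transfer (rule hecke_relator_rel, simp add: hecke_relators_def)

lemma hecke_quadratic_1: "T1 ^ 2 = (qK - 1) *\<^sub>H T1 + qK *\<^sub>H 1"
  unfolding power2_eq_square
  by transfer (rule hecke_relator_rel, auto simp: hecke_relators_def power2_eq_square)

lemma hecke_quadratic_2: "T2 ^ 2 = (qK - 1) *\<^sub>H T2 + qK *\<^sub>H 1"
  unfolding power2_eq_square
  by transfer (rule hecke_relator_rel, auto simp: hecke_relators_def power2_eq_square)

definition hecke_inv :: "hecke3 \<Rightarrow> hecke3" where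
  "hecke_inv x = (THE y. x * y = 1 \<and> y * x = 1)"

lemma hecke_inv_eqI:
  assumes "x * y = 1" "y * x = 1"
  shows "hecke_inv x = y"
  unfolding hecke_inv_def
proof (rule the_equality)
  fix w
  assume "x * w = 1 \<and> w * x = 1"
  then show "w = y" using assms by (metis mult.assoc mult_1_left mult_1_right)
qed (use assms in simp)

lemma qK_nonzero: "qK \<noteq> 0"
  by (simp add: qK_def Zero_fract_def eq_fract)

lemma hecke_inv_T2: "hecke_inv T2 = inverse qK *\<^sub>H (T2 - (qK - 1) *\<^sub>H 1)"
proof -
  interpret V: vector_space hecke_scale by (rule vector_space_hecke3)
  have "T2 * T2 - (qK - 1) *\<^sub>H T2 = qK *\<^sub>H 1"
    using hecke_quadratic_2 by (simp add: power2_eq_square)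
  then show ?thesis
    by (intro hecke_inv_eqI)
      (simp_all add: hecke_scale_mult_left hecke_scale_mult_right right_diff_distrib
        left_diff_distrib qK_nonzero)
qed

end

(* The recursion is right multiplication by T1 T2 - (q-1) T1 = q T1 T2^-1, compared coefficientwise.
   Comparing coefficients requires the six spanning elements to be linearly independent; for this
   the left regular representation is written down on K^6, and each spanning element sends the
   first standard basis vector to a standard basis vector. *)

theory Submission
  imports Defs
begin

section \<open>Embedding the integer polynomials in the field\<close>

lemma of_Zq_0: "of_Zq 0 = 0"
  by (simp add: of_Zq_def)

lemma of_Zq_pCons: "of_Zq (pCons a p) = of_int a + qK * of_Zq p"
  by (simp add: of_Zq_def map_poly_pCons)

lemma of_Zq_add: "of_Zq (p + r) = of_Zq p + of_Zq r"
  by (induction p r rule: poly_induct2) (simp_all add: of_Zq_0 of_Zq_pCons algebra_simps)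

lemma of_Zq_uminus: "of_Zq (- p) = - of_Zq p"
  using of_Zq_add[of p "- p"] by (simp add: of_Zq_0 eq_neg_iff_add_eq_0 add.commute)

lemma of_Zq_diff: "of_Zq (p - r) = of_Zq p - of_Zq r"
  using of_Zq_add[of p "- r"] by (simp add: of_Zq_uminus)

lemma of_Zq_smult: "of_Zq (smult a p) = of_int a * of_Zq p"
  by (induction p) (simp_all add: of_Zq_0 of_Zq_pCons algebra_simps)

lemma of_Zq_mult: "of_Zq (p * r) = of_Zq p * of_Zq r"
  by (induction p) (simp_all add: of_Zq_0 of_Zq_pCons of_Zq_add of_Zq_smult algebra_simps)

lemma of_Zq_1: "of_Zq 1 = 1"
  by (simp add: one_pCons of_Zq_pCons of_Zq_0)

lemma of_Zq_qZ: "of_Zq qZ = qK"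
  by (simp add: of_Zq_pCons of_Zq_0)

lemma of_int_fract: "of_int a = Fract (of_int a :: 'a :: idom) 1"
proof -
  have nat: "of_nat n = Fract (of_nat n :: 'a) 1" for n
    by (induction n) (simp_all add: Zero_fract_def One_fract_def)
  show ?thesis
    by (cases a rule: int_cases2) (simp_all add: nat)
qed

text \<open>Evaluation at \<open>qK\<close> only ever produces denominator 1 and numerators constant
  in z, so the polynomial stays visible inside the fraction and injectivity can be read off.\<close>

lemma of_Zq_eq_Fract: "of_Zq p = Fract [:map_poly of_int p:] 1"
proof (induction p)
  case 0
  then show ?case by (simp add: of_Zq_0 Zero_fract_def)
next
  case (pCons a p)
  have "(of_int a :: complex poly poly) = [:[:of_int a:]:]"
    by (simp add: of_int_poly)
  with pCons show ?case
    by (simp add: of_Zq_pCons of_int_fract qK_def map_poly_pCons)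
qed

text \<open>Holds because \<open>qK\<close> is an indeterminate and the characteristic is 0. It
  carries identities between coefficients in K back to Z[q].\<close>

lemma of_Zq_eq_iff: "of_Zq p = of_Zq r \<longleftrightarrow> p = r"
proof
  assume "of_Zq p = of_Zq r"
  then have "map_poly (of_int :: int \<Rightarrow> complex) p = map_poly of_int r"
    by (simp add: of_Zq_eq_Fract eq_fract)
  then have "of_int (coeff p i) = (of_int (coeff r i) :: complex)" for i
    by (metis coeff_map_poly of_int_0)
  then show "p = r" by (simp add: poly_eq_iff)
qed simp


section \<open>The left regular representation\<close>

datatype basis = B0 | B1 | B2 | B12 | B21 | B121

type_synonym coords = "basis \<Rightarrow> ratfun"

text \<open>Left multiplication in coordinates, from the rule that T_s T_w is T_sw if the length
  goes up and q T_sw + (q-1) T_w if it goes down. Entry \<open>b\<close> collects what the basis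
  elements \<open>b\<close> and its partner under s contribute to \<open>b\<close>. The pair
  \<open>B12\<close>, \<open>B121\<close> under \<open>G2\<close> uses the braid relation.\<close>

fun gen_act :: "gen \<Rightarrow> coords \<Rightarrow> coords" where
  "gen_act G1 v B0 = qK * v B1"
| "gen_act G1 v B1 = v B0 + (qK - 1) * v B1"
| "gen_act G1 v B2 = qK * v B12"
| "gen_act G1 v B12 = v B2 + (qK - 1) * v B12"
| "gen_act G1 v B21 = qK * v B121"
| "gen_act G1 v B121 = v B21 + (qK - 1) * v B121"
| "gen_act G2 v B0 = qK * v B2"
| "gen_act G2 v B2 = v B0 + (qK - 1) * v B2"
| "gen_act G2 v B1 = qK * v B21"
| "gen_act G2 v B21 = v B1 + (qK - 1) * v B21"
| "gen_act G2 v B12 = qK * v B121"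
| "gen_act G2 v B121 = v B12 + (qK - 1) * v B121"

text \<open>With \<open>foldr\<close> the last letter acts first, as a left action requires.\<close>

definition word_act :: "gen_word \<Rightarrow> coords \<Rightarrow> coords" where
  "word_act w = foldr gen_act (letters w)"

definition free_act :: "free_alg \<Rightarrow> coords \<Rightarrow> coords" where
  "free_act f v b =
     (\<Sum>w\<in>Poly_Mapping.keys f. Poly_Mapping.lookup f w * word_act w v b)"

lemma gen_act_add: "gen_act g (\<lambda>b. u b + v b) = (\<lambda>b. gen_act g u b + gen_act g v b)"
proof
  show "gen_act g (\<lambda>b. u b + v b) b = gen_act g u b + gen_act g v b" for b
    by (cases g; cases b) (simp_all add: algebra_simps)
qed

lemma gen_act_scale: "gen_act g (\<lambda>b. c * v b) = (\<lambda>b. c * gen_act g v b)"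
proof
  show "gen_act g (\<lambda>b. c * v b) b = c * gen_act g v b" for b
    by (cases g; cases b) (simp_all add: algebra_simps)
qed

lemma word_act_add: "word_act w (\<lambda>b. u b + v b) = (\<lambda>b. word_act w u b + word_act w v b)"
proof -
  have "foldr gen_act gs (\<lambda>b. u b + v b) = (\<lambda>b. foldr gen_act gs u b + foldr gen_act gs v b)" for gs
    by (induction gs) (simp_all add: gen_act_add)
  then show ?thesis by (simp add: word_act_def)
qed

lemma word_act_scale: "word_act w (\<lambda>b. c * v b) = (\<lambda>b. c * word_act w v b)"
proof -
  have "foldr gen_act gs (\<lambda>b. c * v b) = (\<lambda>b. c * foldr gen_act gs v b)" for gs
    by (induction gs) (simp_all add: gen_act_scale)
  then show ?thesis by (simp add: word_act_def)
qed

lemma word_act_plus: "word_act (u + w) v = word_act u (word_act w v)"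
  by (simp add: word_act_def plus_gen_word_def)

lemma free_act_superset:
  assumes "finite A" "Poly_Mapping.keys f \<subseteq> A"
  shows "free_act f v b = (\<Sum>w\<in>A. Poly_Mapping.lookup f w * word_act w v b)"
  unfolding free_act_def using assms
  by (intro sum.mono_neutral_left) (auto simp: in_keys_iff)

lemma free_act_add: "free_act (f + g) v = (\<lambda>b. free_act f v b + free_act g v b)"
proof
  fix b
  let ?A = "Poly_Mapping.keys f \<union> Poly_Mapping.keys g"
  have "Poly_Mapping.keys (f + g) \<subseteq> ?A" by (rule keys_add)
  then show "free_act (f + g) v b = free_act f v b + free_act g v b"
    by (simp add: free_act_superset[of ?A] lookup_add distrib_right sum.distrib)
qed

lemma free_act_0: "free_act 0 v = (\<lambda>b. 0)"
  by (simp add: free_act_def fun_eq_iff)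

lemma free_act_diff: "free_act (f - g) v = (\<lambda>b. free_act f v b - free_act g v b)"
  using free_act_add[of "f - g" g v] by (simp add: fun_eq_iff)

lemma free_act_single: "free_act (Poly_Mapping.single w c) v = (\<lambda>b. c * word_act w v b)"
  by (cases "c = 0") (simp_all add: free_act_def fun_eq_iff)

text \<open>Both sides are additive in \<open>f\<close> and, once \<open>f\<close> is a monomial, in
  \<open>g\<close>; for two monomials it is compatibility of the word action with
  concatenation.\<close>

lemma free_act_mult: "free_act (f * g) v = free_act f (free_act g v)"
proof (induction f rule: free_alg_induct)
  case (single u c)
  show ?case
  proof (induction g rule: free_alg_induct)
    case (single w d)
    then show ?case
      by (simp add: mult_single free_act_single word_act_plus word_act_scale mult.assoc)
  next
    case (sum g h)
    then show ?case
      by (simp add: distrib_left free_act_add) (simp add: free_act_single word_act_add distrib_left)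
  qed
next
  case (sum f h)
  then show ?case by (simp add: distrib_right free_act_add)
qed

lemma free_act_const: "free_act (free_const c) v = (\<lambda>b. c * v b)"
  by (simp add: free_const_def free_act_single word_act_def zero_gen_word_def)

lemma free_act_gen: "free_act (free_gen g) v = gen_act g v"
  by (simp add: free_gen_def free_act_single word_act_def)

text \<open>Each relation is tested on an arbitrary vector, one coordinate at a time. This makes K^6
  a module over H_3 without presupposing that the six elements form a basis.\<close>

lemma free_act_relators:
  assumes "r \<in> hecke_relators"
  shows "free_act r v = (\<lambda>b. 0)"
proof
  fix b
  have braid: "gen_act G1 (gen_act G2 (gen_act G1 v)) b = gen_act G2 (gen_act G1 (gen_act G2 v)) b"
    by (cases b) (simp_all add: algebra_simps)
  have quadratic: "gen_act g (gen_act g v) b = (qK - 1) * gen_act g v b + qK * v b" for g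
    by (cases g; cases b) (simp_all add: algebra_simps)
  from assms show "free_act r v b = 0"
    unfolding hecke_relators_def
    by (auto simp: free_act_diff free_act_mult free_act_gen free_act_const free_act_add
        power2_eq_square braid quadratic)
qed

lemma free_act_zero_vector: "free_act f (\<lambda>b. 0) = (\<lambda>b. 0)"
  using free_act_mult[of f 0 "\<lambda>b. 0"] by (simp add: free_act_0)

text \<open>In \<open>a * r * b\<close> the relator \<open>r\<close> kills whatever vector
  \<open>b\<close> produces, and \<open>a\<close> maps zero to zero. Hence the action descends to
  the quotient.\<close>

lemma free_act_ideal: "x \<in> hecke_ideal \<Longrightarrow> free_act x v = (\<lambda>b. 0)"
  by (induction rule: hecke_ideal.induct)
    (simp_all add: free_act_0 free_act_mult free_act_add free_act_relators free_act_zero_vector)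

lift_definition hecke_act :: "hecke3 \<Rightarrow> coords \<Rightarrow> coords" is free_act
proof
  fix x y v
  assume "hecke_rel x y"
  then have "free_act (x - y) v = (\<lambda>b. 0)"
    by (simp add: hecke_rel_def free_act_ideal)
  then show "free_act x v = free_act y v"
    by (simp add: free_act_diff fun_eq_iff)
qed

lemma hecke_act_add: "hecke_act (x + y) v = (\<lambda>b. hecke_act x v b + hecke_act y v b)"
  by transfer (rule free_act_add)

lemma hecke_act_diff: "hecke_act (x - y) v = (\<lambda>b. hecke_act x v b - hecke_act y v b)"
  by transfer (rule free_act_diff)

lemma hecke_act_mult: "hecke_act (x * y) v = hecke_act x (hecke_act y v)"
  by transfer (rule free_act_mult)

lemma hecke_act_scale: "hecke_act (c *\<^sub>H x) v = (\<lambda>b. c * hecke_act x v b)"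
  by transfer (simp add: free_act_mult free_act_const)

lemma hecke_act_1: "hecke_act 1 v = v"
  by transfer (simp add: free_act_const flip: free_const_1)

lemma hecke_act_T1: "hecke_act T1 v = gen_act G1 v"
  by transfer (rule free_act_gen)

lemma hecke_act_T2: "hecke_act T2 v = gen_act G2 v"
  by transfer (rule free_act_gen)

lemmas hecke_act_simps =
  hecke_act_add hecke_act_diff hecke_act_mult hecke_act_scale hecke_act_1 hecke_act_T1 hecke_act_T2


section \<open>The recursion\<close>

text \<open>The scalar split off here is exactly the change in the normalizing power of q when the
  exponent grows by one.\<close>

lemma T1_mult_inv_T2: "T1 * hecke_inv T2 = inverse qK *\<^sub>H (T1 * T2 - (qK - 1) *\<^sub>H T1)"
  by (simp add: hecke_inv_T2 hecke_scale_mult_right right_diff_distrib)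

theorem theorem3p2:
  fixes C0 C1 C2 C12 C21 C121 :: "nat \<Rightarrow> int poly"
  assumes expansion: "\<And>n. n \<ge> 1 \<Longrightarrow>
    (T1 * hecke_inv T2) ^ n =
      (qK powi (- int n)) *\<^sub>H
        (of_Zq (C0 n) *\<^sub>H 1 + of_Zq (C1 n) *\<^sub>H T1 + of_Zq (C2 n) *\<^sub>H T2
         + of_Zq (C12 n) *\<^sub>H (T1 * T2) + of_Zq (C21 n) *\<^sub>H (T2 * T1)
         + of_Zq (C121 n) *\<^sub>H (T1 * T2 * T1))"
  shows "\<forall>n\<ge>2.
      C0 n = qZ^2 * C21 (n - 1) - qZ * (qZ - 1) * C1 (n - 1)
    \<and> C1 n = - ((qZ - 1)^2) * C1 (n - 1) - (qZ - 1) * C0 (n - 1) + qZ^2 * C121 (n - 1)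
    \<and> C2 n = qZ * C1 (n - 1)
    \<and> C12 n = (qZ - 1) * C1 (n - 1) + C0 (n - 1)
    \<and> C21 n = - (qZ - 1) * C2 (n - 1) + qZ * C12 (n - 1) - (qZ - 1)^2 * C21 (n - 1)
               + qZ * (qZ - 1) * C121 (n - 1)
    \<and> C121 n = C2 (n - 1) + (qZ - 1) * C21 (n - 1)"
proof (intro allI impI)
  fix n :: nat
  assume n: "n \<ge> 2"
  interpret V: vector_space hecke_scale by (rule vector_space_hecke3)
  define X where "X m = of_Zq (C0 m) *\<^sub>H 1 + of_Zq (C1 m) *\<^sub>H T1 + of_Zq (C2 m) *\<^sub>H T2
         + of_Zq (C12 m) *\<^sub>H (T1 * T2) + of_Zq (C21 m) *\<^sub>H (T2 * T1)
         + of_Zq (C121 m) *\<^sub>H (T1 * T2 * T1)" for m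
  define Y where "Y = T1 * T2 - (qK - 1) *\<^sub>H T1"
  \<comment> \<open>The bound on \<open>n\<close> makes the expansion available for both exponents
    \<open>n\<close> and \<open>m\<close>.\<close>
  obtain m where m: "n = Suc m" "m \<ge> 1" using n by (cases n) auto
  \<comment> \<open>The new factor is split off on the right, so that in a left action it is applied
    first and \<open>X m\<close> then acts on an explicit vector.\<close>
  have "(qK powi (- int n)) *\<^sub>H X n = (T1 * hecke_inv T2) ^ m * (T1 * hecke_inv T2)"
    using expansion[of n] m unfolding X_def by (simp only: power_Suc2)
  also have "\<dots> = (qK powi (- int m) * inverse qK) *\<^sub>H (X m * Y)"
    using expansion[of m] m
    by (simp only: T1_mult_inv_T2 hecke_scale_mult_left hecke_scale_mult_right V.scale_scale
        flip: X_def Y_def) (simp add: mult.commute)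
  also have "qK powi (- int m) * inverse qK = qK powi (- int n)"
    using m(1) by (simp add: power_int_minus del: of_nat_Suc)
  finally have XY: "X n = X m * Y"
    using qK_nonzero by simp
  \<comment> \<open>\<open>e0\<close> is the coordinate vector of 1, so the entries of
    \<open>hecke_act (X n) e0\<close> are the six coefficients of \<open>X n\<close>.\<close>
  define e0 :: coords where "e0 b = (if b = B0 then 1 else 0)" for b
  have eq: "hecke_act (X n) e0 b = hecke_act (X m) (hecke_act Y e0) b" for b
    by (simp add: XY hecke_act_mult)
  note act = X_def Y_def e0_def hecke_act_simps
  show "C0 n = qZ^2 * C21 (n - 1) - qZ * (qZ - 1) * C1 (n - 1)
    \<and> C1 n = - ((qZ - 1)^2) * C1 (n - 1) - (qZ - 1) * C0 (n - 1) + qZ^2 * C121 (n - 1)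
    \<and> C2 n = qZ * C1 (n - 1)
    \<and> C12 n = (qZ - 1) * C1 (n - 1) + C0 (n - 1)
    \<and> C21 n = - (qZ - 1) * C2 (n - 1) + qZ * C12 (n - 1) - (qZ - 1)^2 * C21 (n - 1)
               + qZ * (qZ - 1) * C121 (n - 1)
    \<and> C121 n = C2 (n - 1) + (qZ - 1) * C21 (n - 1)"
    \<comment> \<open>The goal is moved into K by injectivity of \<open>of_Zq\<close>. The
      \<open>pCons\<close> product rules are removed so that products with \<open>qZ\<close> survive
      for \<open>of_Zq_mult\<close>.\<close>
    using eq[of B0] eq[of B1] eq[of B2] eq[of B12] eq[of B21] eq[of B121] m(1)
    by (simp add: act power2_eq_square of_Zq_add of_Zq_diff of_Zq_uminus of_Zq_mult of_Zq_1 of_Zq_qZ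
        flip: of_Zq_eq_iff del: mult_pCons_left mult_pCons_right) (simp add: algebra_simps)
qed

end
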